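(* For every prime $p>2$, \[ \sum_{n=0}^{p-1} \frac{42n^2+23n+3}{2^{4n}(2n+1)}\binom{4n}{2n}^2\binom{2n}{n} \equiv 0 \pmod{p} \] and \[ \sum_{n=0}^{p-1}\frac{252n^3 + 384n^2 + 139n + 15}{2^{4n}} \binom{4n}{2n}^2 \binom{2n}{n} \equiv 0 \pmod{p}. \]
   Context: For rational numbers $x,y$ and a prime $p$, $x\equiv y\pmod{p^r}$ means that $x-y$ is a rational number whose $p$-adic valuation is at least $r$. *)

theory Defs
  imports Complex_Main "HOL-Computational_Algebra.Primes"
begin

text \<open>
  The \<open>p\<close>-adic valuation of a nonzero rational. It is also defined at \<open>0\<close>, where the mathematical
  value is \<open>\<infinity>\<close> but this function returns the junk value \<open>0\<close>.
\<close>

definition padic_val :: "nat \<Rightarrow> rat \<Rightarrow> int" where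
  "padic_val p x =
     int (multiplicity (int p) (fst (quotient_of x)))
     - int (multiplicity (int p) (snd (quotient_of x)))"

text \<open>
  Congruence of rationals modulo \<open>p ^ r\<close>. The disjunct \<open>x = y\<close> accounts for the infinite valuation
  of \<open>0\<close>. No \<open>p\<close>-integrality of \<open>x\<close> and \<open>y\<close> separately is required.
\<close>

definition rat_cong_pow :: "nat \<Rightarrow> nat \<Rightarrow> rat \<Rightarrow> rat \<Rightarrow> bool" where
  "rat_cong_pow p r x y \<longleftrightarrow> x = y \<or> padic_val p (x - y) \<ge> int r"

end

theory Submission
  imports Defs "HOL-Number_Theory.Cong"
begin

text \<open>
  Let \<open>p = 2 * m + 1\<close> and \<open>a\<^sub>n = (4n choose 2n)\<^sup>2 (2n choose n) / 16\<^sup>n\<close>. Modulo \<open>p\<close> one has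
  \<open>(2j choose j) \<equiv> (-4)\<^sup>j (m choose j)\<close> for \<open>j < p\<close>, because \<open>-1/2 \<equiv> m\<close>; hence
  \<open>(4n choose 2n) \<equiv> (-4)\<^sup>n (m - n choose n)\<close> for \<open>n \<le> m\<close>, while the terms with
  \<open>n \<ge> m\<close> vanish. With \<open>d = m - 2n\<close>, the weight \<open>(42n\<^sup>2 + 23n + 3) / (2n + 1)\<close> is congruent to
  \<open>-(2d\<^sup>2(d - 1) - nd\<^sup>2 - n\<^sup>3) / (m - n)\<^sup>2\<close>, and with this weight the sum of
  \<open>(2n choose n) (m - n choose n)\<^sup>2\<close> is exactly \<open>0\<close>: it is the value at \<open>k = 0\<close> of the sum over \<open>n\<close> of
  the first member of a WZ pair, which does not depend on \<open>k\<close> and is \<open>0\<close> for large \<open>k\<close>. The WZ pair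
  comes from the one behind Chu and Zhang's acceleration of well-poised series by \<open>(n, k) \<mapsto> (-n, -k)\<close>.

  The second sum is the first one with opposite sign plus the telescoping sum of the
  differences of \<open>4n\<^sup>3 a\<^sub>n\<close>.
\<close>

section \<open>The WZ pair\<close>

text \<open>Free arguments with \<open>n + l + d = m\<close> avoid subtraction in the WZ equation:
  raising \<open>k\<close> moves one unit from \<open>d\<close> to \<open>l\<close>, and raising
  \<open>n\<close> moves two units from \<open>d\<close>, one to \<open>n\<close> and one to
  \<open>l\<close>.\<close>

definition wz_base :: "nat \<Rightarrow> nat \<Rightarrow> nat \<Rightarrow> rat" where
  "wz_base n l d =
     fact (n + l - 1) * fact (n + d - 1) * fact (l + d - 1) / (fact n * fact l * fact d) ^ 2"

definition wz_F :: "nat \<Rightarrow> nat \<Rightarrow> nat \<Rightarrow> rat" where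
  "wz_F n l d = wz_base n l d *
     ((of_nat n + of_nat l) * of_nat d ^ 2 * (of_nat d - 1)
       - of_nat n * of_nat l * of_nat d ^ 2 - of_nat n ^ 2 * of_nat l ^ 2)"

definition wz_G :: "nat \<Rightarrow> nat \<Rightarrow> nat \<Rightarrow> rat" where
  "wz_G n l d = wz_base n l d * of_nat n ^ 2 * (of_nat l + of_nat d) * (of_nat d - of_nat l)"

lemma wz_generic:
  "wz_F (Suc n) (Suc (Suc l)) (Suc d) - wz_F (Suc n) (Suc l) (Suc (Suc d))
   = wz_G (Suc (Suc n)) (Suc (Suc l)) d - wz_G (Suc n) (Suc l) (Suc (Suc d))"
proof -
  define N L D :: rat where "N = of_nat n" and "L = of_nat l" and "D = of_nat d"
  have pos: "N \<ge> 0" "L \<ge> 0" "D \<ge> 0"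
    unfolding N_def L_def D_def by simp_all
  define u v w x y z :: rat where "u = fact n" and "v = fact l" and "w = fact d"
    and "x = fact (n + l + 1)" and "y = fact (n + d + 1)" and "z = fact (l + d + 1)"
  have f0: "fact n = u" "fact l = v" "fact d = w" "u \<noteq> 0" "v \<noteq> 0" "w \<noteq> 0"
    by (simp_all add: u_def v_def w_def)
  have f1: "fact (Suc n) = (N + 1) * u" "fact (Suc l) = (L + 1) * v" "fact (Suc d) = (D + 1) * w"
    by (simp_all add: u_def v_def w_def N_def L_def D_def algebra_simps)
  have f2: "fact (Suc (Suc n)) = (N + 2) * (N + 1) * u"
    "fact (Suc (Suc l)) = (L + 2) * (L + 1) * v" "fact (Suc (Suc d)) = (D + 2) * (D + 1) * w"
    by (simp_all add: u_def v_def w_def N_def L_def D_def algebra_simps)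
  have g: "Suc n + Suc (Suc l) - 1 = Suc (n + l + 1)" "Suc n + Suc d - 1 = n + d + 1"
    "Suc (Suc l) + Suc d - 1 = Suc (l + d + 1)" "Suc n + Suc l - 1 = n + l + 1"
    "Suc n + Suc (Suc d) - 1 = Suc (n + d + 1)" "Suc l + Suc (Suc d) - 1 = Suc (l + d + 1)"
    "Suc (Suc n) + Suc (Suc l) - 1 = Suc (Suc (n + l + 1))" "Suc (Suc n) + d - 1 = n + d + 1"
    "Suc (Suc l) + d - 1 = l + d + 1"
    by simp_all
  have f3: "fact (n + l + 1) = x" "fact (n + d + 1) = y" "fact (l + d + 1) = z"
    "fact (Suc (n + l + 1)) = (N + L + 2) * x" "fact (Suc (n + d + 1)) = (N + D + 2) * y"
    "fact (Suc (l + d + 1)) = (L + D + 2) * z"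
    "fact (Suc (Suc (n + l + 1))) = (N + L + 3) * (N + L + 2) * x"
    by (simp_all add: x_def y_def z_def N_def L_def D_def algebra_simps)
  \<comment> \<open>\<open>K\<close> collects the smallest factorial in each numerator and the
    largest in each denominator. All three values of \<open>wz_base\<close> are then polynomial
    multiples of \<open>K\<close>, and the claim becomes a polynomial identity.\<close>
  define K where "K = x * y * z / ((N + 2) * (N + 1) * u * ((L + 2) * (L + 1) * v) * ((D + 2) * (D + 1) * w)) ^ 2"
  have nz: "N + 1 \<noteq> 0" "L + 1 \<noteq> 0" "D + 1 \<noteq> 0" "N + 2 \<noteq> 0" "L + 2 \<noteq> 0" "D + 2 \<noteq> 0"
    using pos by simp_all
  have b1: "wz_base (Suc n) (Suc (Suc l)) (Suc d) = K * ((N + L + 2) * (L + D + 2) * ((N + 2) * (D + 2)) ^ 2)"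
    unfolding wz_base_def g f1 f2 f3 K_def using nz f0(4-6)
    by (simp add: divide_simps power_mult_distrib)
  have b2: "wz_base (Suc n) (Suc l) (Suc (Suc d)) = K * ((N + D + 2) * (L + D + 2) * ((N + 2) * (L + 2)) ^ 2)"
    unfolding wz_base_def g f1 f2 f3 K_def using nz f0(4-6)
    by (simp add: divide_simps power_mult_distrib)
  have b3: "wz_base (Suc (Suc n)) (Suc (Suc l)) d = K * ((N + L + 3) * (N + L + 2) * ((D + 1) * (D + 2)) ^ 2)"
    unfolding wz_base_def g f0(1-3) f1 f2 f3 K_def using nz f0(4-6)
    by (simp add: divide_simps power_mult_distrib)
  have o: "rat_of_nat (Suc n) = N + 1" "rat_of_nat (Suc l) = L + 1" "rat_of_nat (Suc d) = D + 1"
    "rat_of_nat (Suc (Suc n)) = N + 2" "rat_of_nat (Suc (Suc l)) = L + 2" "rat_of_nat (Suc (Suc d)) = D + 2"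
    "rat_of_nat d = D"
    by (simp_all add: N_def L_def D_def)
  show ?thesis
    unfolding wz_F_def wz_G_def b1 b2 b3 o
    by algebra
qed

lemma wz_F_eq_wz_G_at_zero: "wz_F n l 0 = wz_G n l 0"
  by (simp add: wz_F_def wz_G_def power2_eq_square)

text \<open>Boundary form of the WZ equation for \<open>m = 2n + k + 1\<close>: raising
  \<open>n\<close> would need two units from \<open>d\<close>, so the term of \<open>wz_G\<close> at
  the next \<open>n\<close> is missing.\<close>

lemma wz_step_one:
  "wz_F (Suc n) (Suc (Suc l)) 0 - wz_F (Suc n) (Suc l) 1 = - wz_G (Suc n) (Suc l) 1"
proof -
  define N L u v x :: rat where "N = of_nat n" and "L = of_nat l"
    and "u = fact n" and "v = fact l" and "x = fact (n + l + 1)"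
  have nz: "N + 1 \<noteq> 0" "L + 1 \<noteq> 0" "L + 2 \<noteq> 0" "u \<noteq> 0" "v \<noteq> 0"
    using of_nat_0_le_iff[of n, where 'a = rat] of_nat_0_le_iff[of l, where 'a = rat]
    by (auto simp: N_def L_def u_def v_def)
  have f: "fact (Suc n) = (N + 1) * u" "fact (Suc l) = (L + 1) * v"
    "fact (Suc (Suc l)) = (L + 2) * (L + 1) * v"  "fact n = u"
    "fact (n + l + 1) = x" "fact (Suc (n + l + 1)) = (N + L + 2) * x"
    by (simp_all add: u_def v_def x_def N_def L_def algebra_simps)
  have g: "Suc n + Suc (Suc l) - 1 = Suc (n + l + 1)" "Suc n + 0 - 1 = n"
    "Suc (Suc l) + 0 - 1 = Suc l" "Suc n + Suc l - 1 = n + l + 1"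
    "Suc n + 1 - 1 = Suc n" "Suc l + 1 - 1 = Suc l"
    by simp_all
  define K where "K = x * u / ((N + 1) * u * ((L + 2) * (L + 1) * v)) ^ 2 * (L + 1) * v"
  have b1: "wz_base (Suc n) (Suc (Suc l)) 0 = K * (N + L + 2)"
    unfolding wz_base_def g f K_def using nz
    by (simp add: divide_simps power_mult_distrib)
  have b2: "wz_base (Suc n) (Suc l) 1 = K * ((N + 1) * (L + 2) ^ 2)"
    unfolding wz_base_def g f K_def using nz
    by (simp add: divide_simps power_mult_distrib)
  have o: "rat_of_nat (Suc n) = N + 1" "rat_of_nat (Suc l) = L + 1" 
    "rat_of_nat (Suc (Suc l)) = L + 2" "rat_of_nat 0 = 0" "rat_of_nat 1 = 1"
    by (simp_all add: N_def L_def)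
  show ?thesis
    unfolding wz_F_def wz_G_def b1 b2 o
    by (simp add: power2_eq_square) algebra
qed

text \<open>
  In the WZ pair, \<open>l = n + k\<close> and \<open>d = m - 2 * n - k\<close>. At \<open>n = 0\<close> the truncated
  subtraction in \<open>wz_base\<close> would give a wrong value for \<open>k = 0\<close>, so the first member is
  given there in its simplified form.
\<close>

definition wz_F_total :: "nat \<Rightarrow> nat \<Rightarrow> nat \<Rightarrow> rat" where
  "wz_F_total m n k =
     (if n = 0 then (if k + 2 \<le> m then fact (m - 1) / (fact k * fact (m - k - 2)) else 0)
      else if 2 * n + k \<le> m then wz_F n (n + k) (m - 2 * n - k) else 0)"

definition wz_G_total :: "nat \<Rightarrow> nat \<Rightarrow> nat \<Rightarrow> rat" where
  "wz_G_total m n k =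
     (if n = 0 \<or> m < 2 * n + k then 0 else wz_G n (n + k) (m - 2 * n - k))"

lemma wz_zero:
  "wz_F_total m 0 (Suc k) - wz_F_total m 0 k = wz_G_total m 1 k"
proof (cases "k + 2 \<le> m")
  case True
  then obtain d where m: "m = k + 2 + d"
    using le_Suc_ex by blast
  \<comment> \<open>The factor \<open>of_nat d\<close> lets one formula cover \<open>d = 0\<close>,
    where \<open>wz_F_total\<close> takes its value 0 outside the support.\<close>
  have F1: "wz_F_total m 0 (Suc k) = fact (k + d + 1) * of_nat d / (fact (Suc k) * fact d)"
  proof (cases d)
    case (Suc j)
    have "fact (Suc j) = (of_nat (Suc j) * fact j :: rat)"
      by simp
    then show ?thesis
      by (simp add: m Suc wz_F_total_def del: fact_Suc of_nat_Suc)
  qed (simp add: m wz_F_total_def)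
  have F0: "wz_F_total m 0 k = fact (k + d + 1) * of_nat (Suc k) / (fact (Suc k) * fact d)"
    by (simp add: m wz_F_total_def)
  have "wz_G_total m 1 k = wz_G 1 (Suc k) d"
    by (simp add: m wz_G_total_def)
  also have "\<dots> = (of_nat (k + d + 1) * fact (k + d)) * (of_nat d - of_nat (Suc k)) / (fact (Suc k) * fact d)"
    by (simp add: wz_G_def wz_base_def power2_eq_square algebra_simps del: fact_Suc)
  also have "of_nat (k + d + 1) * fact (k + d) = (fact (k + d + 1) :: rat)"
    by simp
  finally show ?thesis
    unfolding F1 F0 by (simp add: diff_divide_distrib right_diff_distrib del: fact_Suc of_nat_Suc)
qed (simp add: wz_F_total_def wz_G_total_def)

lemma wz_step:
  "wz_F_total m n (Suc k) - wz_F_total m n k = wz_G_total m (Suc n) k - wz_G_total m n k"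
proof (cases n)
  case 0
  then show ?thesis
    using wz_zero[of m k] by (simp add: wz_G_total_def)
next
  case n: (Suc n')
  show ?thesis
  proof (cases "2 * n + k \<le> m")
    case True
    then obtain d where m: "m = 2 * n + k + d"
      using le_Suc_ex by blast
    \<comment> \<open>The size of \<open>d\<close> decides which terms are in range: for
      \<open>d = 0\<close> neither shifted term survives, for \<open>d = 1\<close> only the one with
      \<open>k\<close> raised, and from \<open>d = 2\<close> on both.\<close>
    show ?thesis
    proof (cases d)
      case 0
      then show ?thesis
        by (simp add: m n wz_F_total_def wz_G_total_def wz_F_eq_wz_G_at_zero)
    next
      case d: (Suc d')
      show ?thesis
      proof (cases d')
        case 0
        then show ?thesis
          using wz_step_one[of n' "n' + k"]
          by (simp add: m n d wz_F_total_def wz_G_total_def)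
      next
        case (Suc d'')
        then show ?thesis
          using wz_generic[of n' "n' + k" d'']
          by (simp add: m n d wz_F_total_def wz_G_total_def)
      qed
    qed
  qed (simp add: wz_F_total_def wz_G_total_def n)
qed

lemma sum_wz_F_total: "(\<Sum>n\<le>m. wz_F_total m n k) = 0"
proof -
  have step: "(\<Sum>n\<le>m. wz_F_total m n (Suc k)) = (\<Sum>n\<le>m. wz_F_total m n k)" for k
  proof -
    have "(\<Sum>n\<le>m. wz_F_total m n (Suc k)) - (\<Sum>n\<le>m. wz_F_total m n k)
        = (\<Sum>n\<le>m. wz_G_total m (Suc n) k - wz_G_total m n k)"
      by (simp add: wz_step flip: sum_subtractf)
    also have "\<dots> = wz_G_total m (Suc m) k - wz_G_total m 0 k"
      unfolding lessThan_Suc_atMost[symmetric] by (rule sum_lessThan_telescope)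
    also have "\<dots> = 0"
      by (simp add: wz_G_total_def)
    finally show ?thesis by simp
  qed
  have "(\<Sum>n\<le>m. wz_F_total m n (k + j)) = (\<Sum>n\<le>m. wz_F_total m n k)" for j
    by (induction j) (simp_all add: step)
  \<comment> \<open>Shifting \<open>k\<close> by \<open>m\<close> leaves the support for every
    \<open>n\<close>, including the separate case \<open>n = 0\<close>.\<close>
  moreover have "(\<Sum>n\<le>m. wz_F_total m n (k + m)) = 0"
    by (intro sum.neutral) (auto simp: wz_F_total_def)
  ultimately show ?thesis by metis
qed

text \<open>At \<open>k = 0\<close> one has \<open>l = n\<close>, and the product of binomials
  equals \<open>2n (m - n)^2\<close> times \<open>wz_base n n d\<close>. The polynomial in
  \<open>wz_F\<close> also contains a factor \<open>n\<close>; cancelling it leaves the factor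
  2.\<close>

lemma wz_F_total_zero_right:
  assumes "m \<ge> 1" "n \<le> m"
  shows "2 * wz_F_total m n 0 =
    of_nat ((2 * n) choose n) * of_nat ((m - n) choose n) ^ 2 *
      (2 * (of_nat m - 2 * of_nat n) ^ 2 * (of_nat m - 2 * of_nat n - 1)
        - of_nat n * (of_nat m - 2 * of_nat n) ^ 2 - of_nat n ^ 3) / (of_nat m - of_nat n) ^ 2"
proof -
  consider "n = 0" | "m < 2 * n" | "n > 0" "2 * n \<le> m" by linarith
  then show ?thesis
  proof cases
    case 1
    show ?thesis
    proof (cases "m = 1")
      case False
      then obtain j where "m = j + 2"
        using assms(1) le_Suc_ex[of 2 m] by (metis One_nat_def Suc_1 add.commute le_neq_implies_less Suc_leI)
      then show ?thesis
        using 1 by (simp add: wz_F_total_def field_simps)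
    qed (simp add: 1 wz_F_total_def)
  next
    case 2
    \<comment> \<open>This case includes \<open>n = m\<close>, where the divisor is 0; the vanishing
      binomial makes the right-hand side 0 anyway.\<close>
    then have "(m - n) choose n = 0"
      using assms by (intro binomial_eq_0) linarith
    then show ?thesis
      using 2 by (simp add: wz_F_total_def)
  next
    case 3
    then obtain j where j: "n = Suc j"
      by (cases n) auto
    obtain d where m: "m = 2 * n + d"
      using 3 le_Suc_ex by blast
    have c1: "rat_of_nat ((2 * n) choose n) = 2 * of_nat n * fact (n + n - 1) / fact n ^ 2"
    proof -
      have "2 * n = Suc (n + n - 1)"
        by (simp add: j)
      then have "fact (2 * n) = (of_nat (2 * n) * fact (n + n - 1) :: rat)"
        by (metis fact_Suc)
      then show ?thesis
        by (simp add: binomial_fact power2_eq_square)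
    qed
    have c2: "rat_of_nat ((m - n) choose n) = (of_nat n + of_nat d) * fact (n + d - 1) / (fact n * fact d)"
    proof -
      have "fact (n + d) = ((of_nat n + of_nat d) * fact (n + d - 1) :: rat)"
        by (simp add: j algebra_simps)
      moreover have "m - n = n + d" by (simp add: m)
      ultimately show ?thesis
        by (simp add: binomial_fact)
    qed
    have nz: "rat_of_nat n + of_nat d \<noteq> 0"
      using 3 by (metis of_nat_add of_nat_eq_0_iff add_is_0 less_irrefl)
    have F: "wz_F_total m n 0 = wz_F n n d"
      using 3 by (simp add: wz_F_total_def m)
    have o: "rat_of_nat m = 2 * of_nat n + of_nat d"
      by (simp add: m)
    show ?thesis
      unfolding F c1 c2 o wz_F_def wz_base_def
      using nz
      by (simp add: divide_simps) (simp add: algebra_simps power2_eq_square power3_eq_cube power4_eq_xxxx)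
  qed
qed

lemma sum_binomial_eq_zero:
  fixes m :: nat
  assumes "m \<ge> 1"
  shows "(\<Sum>n\<le>m. of_nat ((2 * n) choose n) * of_nat ((m - n) choose n) ^ 2 *
      (2 * (of_nat m - 2 * of_nat n) ^ 2 * (of_nat m - 2 * of_nat n - 1)
        - of_nat n * (of_nat m - 2 * of_nat n) ^ 2 - of_nat n ^ 3) / (of_nat m - of_nat n) ^ 2)
      = (0 :: rat)" (is "sum ?f _ = 0")
proof -
  have "sum ?f {..m} = (\<Sum>n\<le>m. 2 * wz_F_total m n 0)"
    by (intro sum.cong refl wz_F_total_zero_right[symmetric]) (use assms in auto)
  also have "\<dots> = 0"
    by (simp add: sum_wz_F_total flip: sum_distrib_left)
  finally show ?thesis .
qed

section \<open>Lower bounds for p-adic valuations\<close>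

text \<open>The fraction may be unreduced, so sums and products need no cancellation, and 0 is
  covered without a special case.\<close>

definition padic_ge :: "nat \<Rightarrow> nat \<Rightarrow> rat \<Rightarrow> bool" where
  "padic_ge p r x \<longleftrightarrow>
     (\<exists>a b. x = of_int a / of_int b \<and> \<not> int p dvd b \<and> int p ^ r dvd a)"

lemma padic_geI:
  "x = of_int a / of_int b \<Longrightarrow> \<not> int p dvd b \<Longrightarrow> int p ^ r dvd a \<Longrightarrow> padic_ge p r x"
  unfolding padic_ge_def by blast

lemma padic_ge_of_int:
  assumes "prime p" "int p ^ r dvd a"
  shows "padic_ge p r (of_int a)"
  by (rule padic_geI[of _ a 1]) (use assms in \<open>auto dest: prime_gt_1_nat\<close>)

lemma padic_ge_mult:
  assumes "prime p" "padic_ge p r x" "padic_ge p s y"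
  shows "padic_ge p (r + s) (x * y)"
proof -
  obtain a b where x: "x = of_int a / of_int b" "\<not> int p dvd b" "int p ^ r dvd a"
    using assms(2) unfolding padic_ge_def by blast
  obtain c d where y: "y = of_int c / of_int d" "\<not> int p dvd d" "int p ^ s dvd c"
    using assms(3) unfolding padic_ge_def by blast
  show ?thesis
  proof (rule padic_geI)
    show "x * y = of_int (a * c) / of_int (b * d)"
      using x(1) y(1) by simp
    show "\<not> int p dvd b * d"
      using x(2) y(2) assms(1) by (simp add: prime_dvd_mult_iff)
    show "int p ^ (r + s) dvd a * c"
      using x(3) y(3) by (simp add: power_add mult_dvd_mono)
  qed
qed

lemma padic_ge_add:
  assumes "prime p" "padic_ge p r x" "padic_ge p r y"
  shows "padic_ge p r (x + y)"
proof -
  obtain a b where x: "x = of_int a / of_int b" "\<not> int p dvd b" "int p ^ r dvd a"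
    using assms(2) unfolding padic_ge_def by blast
  obtain c d where y: "y = of_int c / of_int d" "\<not> int p dvd d" "int p ^ r dvd c"
    using assms(3) unfolding padic_ge_def by blast
  show ?thesis
  proof (rule padic_geI)
    have "b \<noteq> 0" "d \<noteq> 0"
      using x(2) y(2) by auto
    then show "x + y = of_int (a * d + c * b) / of_int (b * d)"
      using x(1) y(1) by (simp add: field_simps)
    show "\<not> int p dvd b * d"
      using x(2) y(2) assms(1) by (simp add: prime_dvd_mult_iff)
    show "int p ^ r dvd a * d + c * b"
      using x(3) y(3) by simp
  qed
qed

lemma padic_ge_diff:
  assumes "prime p" "padic_ge p r x" "padic_ge p r y"
  shows "padic_ge p r (x - y)"
proof -
  have "padic_ge p (0 + r) (of_int (- 1) * y)"
    using assms by (intro padic_ge_mult padic_ge_of_int) auto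
  then show ?thesis
    using padic_ge_add[OF assms(1,2), of "- y"] by simp
qed

lemma padic_ge_sum:
  assumes "prime p" "\<And>i. i \<in> A \<Longrightarrow> padic_ge p r (f i)"
  shows "padic_ge p r (sum f A)"
  using assms(2)
proof (induction A rule: infinite_finite_induct)
  case (insert i A)
  then show ?case
    using assms(1) by (simp add: padic_ge_add)
qed (use padic_ge_of_int[OF assms(1), of r 0] in auto)

text \<open>Cross-multiplying with the reduced fraction gives \<open>u * b = a * v\<close>. Since
  \<open>p\<close> does not divide \<open>b\<close>, comparing multiplicities shows that the
  valuation of \<open>x\<close> is the multiplicity of \<open>p\<close> in \<open>a\<close>.\<close>

lemma rat_cong_pow_if_padic_ge:
  assumes "prime p" "padic_ge p r x"
  shows "rat_cong_pow p r x 0"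
proof (cases "x = 0")
  case False
  obtain a b where ab: "x = of_int a / of_int b" "\<not> int p dvd b" "int p ^ r dvd a"
    using assms(2) unfolding padic_ge_def by blast
  obtain u v where uv: "quotient_of x = (u, v)"
    by (cases "quotient_of x")
  have v: "v > 0" and x: "x = of_int u / of_int v"
    using quotient_of_denom_pos[OF uv] quotient_of_div[OF uv] by auto
  have "b \<noteq> 0" "a \<noteq> 0" "u \<noteq> 0"
    using ab x False by auto
  have "rat_of_int (u * b) = of_int (a * v)"
    using ab(1) x v \<open>b \<noteq> 0\<close> by (simp add: field_simps)
  then have eq: "u * b = a * v"
    by (simp only: of_int_eq_iff)
  have pr: "prime_elem (int p)"
    using assms(1) by auto
  have "multiplicity (int p) u + multiplicity (int p) b = multiplicity (int p) (u * b)"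
    using pr \<open>u \<noteq> 0\<close> \<open>b \<noteq> 0\<close> by (simp add: prime_elem_multiplicity_mult_distrib)
  also have "\<dots> = multiplicity (int p) a + multiplicity (int p) v"
    using pr \<open>a \<noteq> 0\<close> v by (simp add: eq prime_elem_multiplicity_mult_distrib)
  finally have "multiplicity (int p) u = multiplicity (int p) a + multiplicity (int p) v"
    using ab(2) by (simp add: not_dvd_imp_multiplicity_0)
  moreover have "multiplicity (int p) a \<ge> r"
    using ab(3) \<open>a \<noteq> 0\<close> assms(1) by (intro multiplicity_geI) auto
  ultimately show ?thesis
    by (simp add: rat_cong_pow_def padic_val_def uv)
qed (simp add: rat_cong_pow_def)

section \<open>Central binomial coefficients modulo p\<close>

lemma central_binomial_Suc:
  "Suc j * ((2 * Suc j) choose Suc j) = 2 * (2 * j + 1) * ((2 * j) choose j)"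
proof -
  let ?B = "Suc (2 * j) choose j"
  have "?B = Suc (2 * j) choose Suc j"
    using binomial_symmetric[of j "Suc (2 * j)"] by simp
  then have B: "Suc j * ?B = Suc (2 * j) * ((2 * j) choose j)"
    using Suc_times_binomial_eq[of "2 * j" j] by (metis mult.commute)
  have "2 * Suc j = Suc (Suc (2 * j))"
    by simp
  then have "Suc j * ((2 * Suc j) choose Suc j) = (2 * Suc j) * ?B"
    using Suc_times_binomial_eq[of "Suc (2 * j)" j] by (metis mult.commute)
  also have "\<dots> = 2 * (Suc j * ?B)"
    by (simp only: mult.assoc)
  finally show ?thesis
    unfolding B by simp
qed

text \<open>Both sides satisfy first-order recurrences in \<open>j\<close>, with multipliers
  \<open>2(2j + 1)\<close> and \<open>-4(m - j)\<close> that differ by \<open>2p\<close>. The common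
  factor \<open>j + 1\<close> on the left is less than \<open>p\<close> and can be
  cancelled.\<close>

lemma central_binomial_cong:
  fixes m j :: nat
  assumes "prime (2 * m + 1)" "j < 2 * m + 1"
  shows "[int ((2 * j) choose j) = (- 4) ^ j * int (m choose j)] (mod int (2 * m + 1))"
  using assms(2)
proof (induction j)
  case (Suc j)
  let ?p = "int (2 * m + 1)"
  have lhs: "int (Suc j) * int ((2 * Suc j) choose Suc j) = 2 * (2 * int j + 1) * int ((2 * j) choose j)"
    using arg_cong[OF central_binomial_Suc[of j], of int] unfolding of_nat_mult by simp
  have "int (Suc j) * int (m choose Suc j) = (int m - int j) * int (m choose j)"
  proof (cases "j \<le> m")
    case True
    have "Suc j * (m choose Suc j) = (m - j) * (m choose j)"
      using binomial_absorb_comp[of m j] binomial_absorption[of j m] by simp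
    then show ?thesis
      using True by (metis of_nat_diff of_nat_mult)
  qed (simp add: binomial_eq_0)
  then have "(- 4) ^ Suc j * (int (Suc j) * int (m choose Suc j))
      = - 4 * (int m - int j) * ((- 4) ^ j * int (m choose j))"
    by (simp only: power_Suc mult_ac)
  then have rhs: "int (Suc j) * ((- 4) ^ Suc j * int (m choose Suc j))
      = - 4 * (int m - int j) * ((- 4) ^ j * int (m choose j))"
    by (simp only: mult.left_commute)
  have "[int (Suc j) * int ((2 * Suc j) choose Suc j)
      = int (Suc j) * ((- 4) ^ Suc j * int (m choose Suc j))] (mod ?p)"
    unfolding lhs rhs
  proof (rule cong_mult)
    show "[int (2 * j choose j) = (- 4) ^ j * int (m choose j)] (mod ?p)"
      using Suc by simp
    have "2 * (2 * int j + 1) - - 4 * (int m - int j) = ?p * 2"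
      by simp
    then show "[2 * (2 * int j + 1) = - 4 * (int m - int j)] (mod ?p)"
      unfolding cong_iff_dvd_diff by (metis dvd_triv_left)
  qed
  moreover have "coprime (int (Suc j)) ?p"
  proof -
    have "\<not> (2 * m + 1) dvd Suc j"
      using Suc.prems by (intro nat_dvd_not_less) auto
    then show ?thesis
      using assms(1) by (metis coprime_commute coprime_int_iff prime_imp_coprime_nat)
  qed
  ultimately show ?case
    using cong_mult_lcancel by blast
qed simp

text \<open>The central congruence at index \<open>2n\<close> gives \<open>m choose 2n\<close>.
  Multiplying by \<open>2n choose n\<close> splits off \<open>m choose n\<close>, which the
  congruence at index \<open>n\<close> turns back into \<open>2n choose n\<close>; as
  \<open>2n < p\<close>, this factor is prime to \<open>p\<close> and cancels.\<close>

lemma binomial_4n_cong: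
  fixes m n :: nat
  assumes "prime (2 * m + 1)" "n \<le> m"
  shows "[int ((4 * n) choose (2 * n)) = (- 4) ^ n * int ((m - n) choose n)] (mod int (2 * m + 1))"
proof -
  let ?p = "int (2 * m + 1)"
  have choose: "(m choose (2 * n)) * ((2 * n) choose n) = (m choose n) * ((m - n) choose n)"
  proof (cases "2 * n \<le> m")
    case True
    then show ?thesis
      using choose_mult[of n "2 * n" m] by simp
  next
    case False
    then have "m choose (2 * n) = 0" "(m - n) choose n = 0"
      using assms by (auto intro!: binomial_eq_0)
    then show ?thesis
      by (simp only: mult_0 mult_0_right)
  qed
  have "[int ((4 * n) choose (2 * n)) * int ((2 * n) choose n)
      = ((- 4) ^ (2 * n) * int (m choose (2 * n))) * int ((2 * n) choose n)] (mod ?p)"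
    using central_binomial_cong[OF assms(1), of "2 * n"] assms(2) by (intro cong_mult) auto
  also have "((- 4) ^ (2 * n) * int (m choose (2 * n))) * int ((2 * n) choose n)
      = (- 4) ^ n * int ((m - n) choose n) * ((- 4) ^ n * int (m choose n))"
    using arg_cong[OF choose, of int] by (simp add: mult_2 power_add)
  also have "[\<dots> = (- 4) ^ n * int ((m - n) choose n) * int ((2 * n) choose n)] (mod ?p)"
    using cong_sym[OF central_binomial_cong[OF assms(1), of n]] assms(2) by (intro cong_mult) auto
  finally have "[int ((4 * n) choose (2 * n)) * int ((2 * n) choose n)
      = (- 4) ^ n * int ((m - n) choose n) * int ((2 * n) choose n)] (mod ?p)" .
  moreover have "coprime (int ((2 * n) choose n)) ?p"
  proof -
    have "\<not> (2 * m + 1) dvd fact (2 * n)"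
      using assms by (simp add: prime_dvd_fact_iff)
    moreover have "((2 * n) choose n) dvd fact (2 * n)"
      using binomial_fact_lemma[of n "2 * n"] by (metis dvd_triv_right le_add2 mult_2)
    ultimately have "\<not> (2 * m + 1) dvd ((2 * n) choose n)"
      using dvd_trans by blast
    then show ?thesis
      using assms(1) by (metis coprime_commute coprime_int_iff prime_imp_coprime_nat)
  qed
  ultimately show ?thesis
    by (simp add: cong_mult_rcancel)
qed

section \<open>Recurrence and telescoping of the summands\<close>

definition summand :: "nat \<Rightarrow> rat" where
  "summand n = of_nat ((4 * n) choose (2 * n)) ^ 2 * of_nat ((2 * n) choose n) / 16 ^ n"

lemma summand_Suc:
  "2 * (2 * of_nat n + 1) * of_nat (Suc n) ^ 3 * summand (Suc n)
   = ((4 * of_nat n + 1) * (4 * of_nat n + 3)) ^ 2 * summand n"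
proof -
  \<comment> \<open>\<open>c1\<close> is the intermediate central binomial: its index runs from
    \<open>2n\<close> to \<open>2n + 2\<close>, so the recurrence is applied twice.\<close>
  define N c0 c1 c2 b0 b1 :: rat where "N = of_nat n" and "c0 = of_nat ((4 * n) choose (2 * n))"
    and "c1 = of_nat ((2 * Suc (2 * n)) choose Suc (2 * n))"
    and "c2 = of_nat ((4 * Suc n) choose (2 * Suc n))"
    and "b0 = of_nat ((2 * n) choose n)" and "b1 = of_nat ((2 * Suc n) choose Suc n)"
  have "N \<ge> 0"
    by (simp add: N_def)
  have c: "(2 * N + 1) * c1 = 2 * (4 * N + 1) * c0"
    using arg_cong[OF central_binomial_Suc[of "2 * n"], of rat_of_nat]
    unfolding of_nat_mult c1_def[symmetric]
    by (simp add: N_def c0_def algebra_simps)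
  have "4 * Suc n = 2 * Suc (Suc (2 * n))" "2 * Suc n = Suc (Suc (2 * n))"
    by simp_all
  then have "c2 = of_nat ((2 * Suc (Suc (2 * n))) choose Suc (Suc (2 * n)))"
    unfolding c2_def by metis
  then have "(2 * N + 2) * c2 = 2 * (4 * N + 3) * c1"
    using arg_cong[OF central_binomial_Suc[of "Suc (2 * n)"], of rat_of_nat]
    unfolding of_nat_mult c1_def[symmetric]
    by (simp add: N_def algebra_simps del: binomial_Suc_Suc)
  then have "(2 * N + 1) * (N + 1) * c2 = (4 * N + 3) * ((2 * N + 1) * c1)"
    by algebra
  then have c2: "(2 * N + 1) * (N + 1) * c2 = 2 * (4 * N + 3) * (4 * N + 1) * c0"
    unfolding c by (simp only: mult_ac)
  have b: "(N + 1) * b1 = 2 * (2 * N + 1) * b0"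
    using arg_cong[OF central_binomial_Suc[of n], of rat_of_nat]
    unfolding of_nat_mult b1_def[symmetric]
    by (simp add: N_def b0_def algebra_simps)
  \<comment> \<open>The extra factor \<open>2N + 1\<close> completes the square of the left side of
    \<open>c2\<close>; it is cancelled afterwards.\<close>
  have "(2 * N + 1) * ((2 * N + 1) * (N + 1) ^ 3 * (c2 ^ 2 * b1))
      = ((2 * N + 1) * (N + 1) * c2) ^ 2 * ((N + 1) * b1)"
    by (simp add: power2_eq_square power3_eq_cube)
  also have "\<dots> = (2 * N + 1) * (8 * ((4 * N + 1) * (4 * N + 3)) ^ 2 * (c0 ^ 2 * b0))"
    unfolding c2 b by algebra
  finally have *: "(2 * N + 1) * (N + 1) ^ 3 * (c2 ^ 2 * b1)
      = 8 * ((4 * N + 1) * (4 * N + 3)) ^ 2 * (c0 ^ 2 * b0)"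
    using \<open>N \<ge> 0\<close> by simp
  have s: "summand (Suc n) = c2 ^ 2 * b1 / (16 * 16 ^ n)" "summand n = c0 ^ 2 * b0 / 16 ^ n"
    by (simp_all only: summand_def c2_def b1_def c0_def b0_def power_Suc)
  have o: "rat_of_nat (Suc n) = N + 1" "rat_of_nat n = N"
    by (simp_all add: N_def)
  have "2 * (2 * N + 1) * (N + 1) ^ 3 * (c2 ^ 2 * b1 / (16 * 16 ^ n))
      = (2 * N + 1) * (N + 1) ^ 3 * (c2 ^ 2 * b1) / (8 * 16 ^ n)"
    by (simp add: divide_simps)
  also have "\<dots> = ((4 * N + 1) * (4 * N + 3)) ^ 2 * (c0 ^ 2 * b0 / 16 ^ n)"
    unfolding * by simp
  finally show ?thesis
    unfolding s o .
qed

lemma sum_cubic_summand: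
  "(\<Sum>n<N. (252 * of_nat n ^ 3 + 384 * of_nat n ^ 2 + 139 * of_nat n + 15) * summand n)
   = 4 * of_nat N ^ 3 * summand N
     - (\<Sum>n<N. (42 * of_nat n ^ 2 + 23 * of_nat n + 3) / (2 * of_nat n + 1) * summand n)"
proof (induction N)
  case (Suc N)
  define x :: rat where "x = of_nat N"
  have "2 * x + 1 > 0"
    by (simp add: x_def add_nonneg_pos)
  have "4 * of_nat (Suc N) ^ 3 * summand (Suc N)
      = 2 * (((4 * x + 1) * (4 * x + 3)) ^ 2 * summand N) / (2 * x + 1)"
    using summand_Suc[of N] \<open>2 * x + 1 > 0\<close> unfolding x_def by (simp add: field_simps del: of_nat_Suc)
  also have "\<dots> = (4 * x ^ 3 + (42 * x ^ 2 + 23 * x + 3) / (2 * x + 1)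
      + (252 * x ^ 3 + 384 * x ^ 2 + 139 * x + 15)) * summand N"
  proof -
    \<comment> \<open>Division by \<open>2x + 1\<close>: the cubic weight, the telescoping
      \<open>4x^3\<close> and the quadratic weight appear together.\<close>
    have "2 * ((4 * x + 1) * (4 * x + 3)) ^ 2
        = (4 * x ^ 3 + (252 * x ^ 3 + 384 * x ^ 2 + 139 * x + 15)) * (2 * x + 1)
          + (42 * x ^ 2 + 23 * x + 3)"
      by (simp add: algebra_simps power2_eq_square power3_eq_cube)
    then have "2 * ((4 * x + 1) * (4 * x + 3)) ^ 2 / (2 * x + 1)
        = 4 * x ^ 3 + (42 * x ^ 2 + 23 * x + 3) / (2 * x + 1)
          + (252 * x ^ 3 + 384 * x ^ 2 + 139 * x + 15)"
      using \<open>2 * x + 1 > 0\<close> by (simp add: add_divide_distrib)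
    then show ?thesis
      by (metis (no_types, opaque_lifting) mult.assoc times_divide_eq_left)
  qed
  finally show ?case
    unfolding sum.lessThan_Suc Suc.IH x_def[symmetric] by (simp add: distrib_right)
qed simp

section \<open>Divisibility of the single terms\<close>

lemma not_dvd_16_power:
  assumes "prime p" "p > 2"
  shows "\<not> int p dvd 16 ^ n"
proof
  assume "int p dvd 16 ^ n"
  then have "p dvd 2 ^ (4 * n)"
    by (simp add: power_mult flip: int_dvd_int_iff)
  then have "p dvd 2"
    using assms(1) by (metis prime_dvd_power)
  then show False
    using assms(2) by (auto dest: dvd_imp_le)
qed

lemma padic_ge_summand_lower_half:
  fixes m n :: nat
  defines "p \<equiv> 2 * m + 1"
  assumes p: "prime p" and m: "m \<ge> 1" and n: "n \<le> m"
  shows "padic_ge p 1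
    ((42 * of_nat n ^ 2 + 23 * of_nat n + 3) / (2 * of_nat n + 1) * summand n
     + of_nat ((2 * n) choose n) * of_nat ((m - n) choose n) ^ 2 *
      (2 * (of_nat m - 2 * of_nat n) ^ 2 * (of_nat m - 2 * of_nat n - 1)
        - of_nat n * (of_nat m - 2 * of_nat n) ^ 2 - of_nat n ^ 3) / (of_nat m - of_nat n) ^ 2)"
    (is "padic_ge p 1 ?t")
proof -
  define b c C where "b = int ((2 * n) choose n)" and "c = int ((4 * n) choose (2 * n))"
    and "C = int ((m - n) choose n)"
  define P where "P = 42 * int n ^ 2 + 23 * int n + 3"
  have not_dvd_16: "\<not> int p dvd 16 ^ n"
    using p m by (intro not_dvd_16_power) (auto simp: p_def)
  have c: "[c = (- 4) ^ n * C] (mod int p)"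
    unfolding c_def C_def p_def using p n unfolding p_def by (rule binomial_4n_cong)
  have s: "summand n = of_int (c ^ 2 * b) / 16 ^ n"
    by (simp add: summand_def b_def c_def)
  have o: "rat_of_nat ((2 * n) choose n) = of_int b" "rat_of_nat ((m - n) choose n) = of_int C"
    "(42 * of_nat n ^ 2 + 23 * of_nat n + 3 :: rat) = of_int P"
    by (simp_all add: b_def C_def P_def)
  show ?thesis
  proof (cases "n = m")
    \<comment> \<open>Here \<open>2n + 1 = p\<close> is in the denominator, but \<open>C = 0\<close>
      forces \<open>p\<close> to divide \<open>c\<close>, so \<open>c^2\<close> supplies two factors
      \<open>p\<close> against one. The second summand, with divisor 0, vanishes as well.\<close>
    case True
    then have "C = 0"
      using m by (simp add: C_def)
    with c obtain y where y: "c = int p * y"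
      by (auto simp: cong_0_iff dvd_def)
    have "rat_of_int P / of_nat p * (of_int ((int p * y) ^ 2 * b) / 16 ^ n)
        = of_int (int p * (P * y ^ 2 * b)) / of_int (16 ^ n)"
      using prime_gt_0_nat[OF p] by (simp add: field_simps power2_eq_square)
    moreover have "2 * of_nat n + 1 = rat_of_nat p"
      by (simp add: True p_def)
    ultimately have "?t = of_int (int p * (P * y ^ 2 * b)) / of_int (16 ^ n)"
      unfolding s o y by (simp add: \<open>C = 0\<close>)
    then show ?thesis
      by (rule padic_geI) (use not_dvd_16 in auto)
  next
    case False
    with n have "n < m" by simp
    have "[c ^ 2 = ((- 4) ^ n * C) ^ 2] (mod int p)"
      using c by (rule cong_pow)
    moreover have "((- 4) ^ n * C) ^ 2 = 16 ^ n * C ^ 2"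
      by (simp add: power_mult_distrib flip: power_mult) (simp add: power_mult mult.commute[of n])
    ultimately have "int p dvd c ^ 2 - 16 ^ n * C ^ 2"
      by (simp add: cong_iff_dvd_diff)
    then obtain z where "c ^ 2 - 16 ^ n * C ^ 2 = int p * z"
      by (auto simp: dvd_def)
    then have z: "c ^ 2 = 16 ^ n * C ^ 2 + int p * z"
      by simp
    define N M :: rat where "N = of_nat n" and "M = of_nat m"
    have pM: "of_nat p = 2 * M + 1"
      by (simp add: p_def M_def)
    have nz: "2 * N + 1 \<noteq> 0" "M - N \<noteq> 0"
      using \<open>n < m\<close> by (auto simp: N_def M_def add_nonneg_eq_0_iff)
    \<comment> \<open>the quotient by \<open>p = 2 * m + 1\<close> in the polynomial identity behind \<open>key\<close>\<close>
    define Q where "Q = 2 * int n * int m ^ 2 + int m ^ 2 + 8 * int n ^ 2 * int m + 2 * int n * int m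
      - 14 * int n ^ 3 - 5 * int n ^ 2"
    have oQ: "of_int Q = 2 * N * M ^ 2 + M ^ 2 + 8 * N ^ 2 * M + 2 * N * M - 14 * N ^ 3 - 5 * N ^ 2"
      by (simp add: Q_def N_def M_def)
    have oP: "of_int P = 42 * N ^ 2 + 23 * N + 3"
      by (simp add: P_def N_def)
    have key: "2 * (M - 2 * N) ^ 2 * (M - 2 * N - 1) - N * (M - 2 * N) ^ 2 - N ^ 3
        = (of_nat p * of_int Q - of_int P * (M - N) ^ 2) / (2 * N + 1)"
      using nz unfolding oQ oP pM
      by (simp add: field_simps) (simp add: algebra_simps power2_eq_square power3_eq_cube)
    \<comment> \<open>By \<open>z\<close> and \<open>key\<close>, the two contributions with
      \<open>P * C^2\<close> cancel; every remaining term carries a factor \<open>p\<close>.\<close>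
    have "?t = of_int (int p * (b * (P * z * (int m - int n) ^ 2 + C ^ 2 * Q * 16 ^ n)))
        / of_int (16 ^ n * (2 * int n + 1) * (int m - int n) ^ 2)"
      unfolding s o z N_def[symmetric] M_def[symmetric] key using nz
      by (simp add: divide_simps flip: N_def M_def) (simp add: algebra_simps oP)
    moreover have "\<not> int p dvd 16 ^ n * (2 * int n + 1) * (int m - int n) ^ 2"
    proof -
      have "\<not> int p dvd 2 * int n + 1" "\<not> int p dvd int m - int n"
        using \<open>n < m\<close> by (auto dest!: zdvd_imp_le simp: p_def)
      moreover have "prime (int p)"
        using p by simp
      ultimately show ?thesis
        using not_dvd_16 by (simp add: prime_dvd_mult_iff prime_dvd_power_iff)
    qed
    ultimately show ?thesis
      by (rule padic_geI) simp
  qed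
qed

lemma padic_ge_summand_upper_half:
  fixes m n :: nat
  defines "p \<equiv> 2 * m + 1"
  assumes p: "prime p" and n: "m < n" "n < p"
  shows "padic_ge p 1 ((42 * of_nat n ^ 2 + 23 * of_nat n + 3) / (2 * of_nat n + 1) * summand n)"
    (is "padic_ge p 1 ?t")
proof -
  have "?t = of_int (int ((2 * n) choose n) * ((42 * int n ^ 2 + 23 * int n + 3) * int ((4 * n) choose (2 * n)) ^ 2))
      / of_int (16 ^ n * (2 * int n + 1))"
    by (simp add: summand_def mult_ac)
  moreover have "\<not> int p dvd 16 ^ n * (2 * int n + 1)"
  proof -
    have "\<not> p dvd 2 * n + 1"
    proof
      assume "p dvd 2 * n + 1"
      \<comment> \<open>From \<open>m < n < p\<close> it follows that \<open>2n + 1\<close> lies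
        strictly between \<open>p\<close> and \<open>2p\<close>.\<close>
      then have "p dvd 2 * n + 1 - p"
        by simp
      then have "p \<le> 2 * n + 1 - p"
        using n by (intro dvd_imp_le) (auto simp: p_def)
      then show False
        using n by simp
    qed
    then have "\<not> int p dvd int (2 * n + 1)"
      by (simp only: int_dvd_int_iff not_False_eq_True)
    moreover have "int (2 * n + 1) = 2 * int n + 1"
      by simp
    moreover have "\<not> int p dvd 16 ^ n"
      using p n by (intro not_dvd_16_power) (auto simp: p_def)
    ultimately show ?thesis
      using p by (metis prime_dvd_mult_iff prime_nat_int_transfer)
  qed
  \<comment> \<open>Since \<open>n > m\<close>, the binomial \<open>m choose n\<close> is 0, and
    \<open>central_binomial_cong\<close> applies because \<open>n < p\<close>.\<close>
  moreover have "int p dvd int ((2 * n) choose n)"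
    using central_binomial_cong[of m n] p n unfolding p_def
    by (simp add: cong_0_iff binomial_eq_0)
  ultimately show ?thesis
    by (metis padic_geI dvd_mult2 power_one_right)
qed

section \<open>The two sums\<close>

lemma padic_ge_sum_quadratic:
  fixes p :: nat
  assumes "prime p" "p > 2"
  shows "padic_ge p 1
    (\<Sum>n<p. (42 * of_nat n ^ 2 + 23 * of_nat n + 3) / (2 * of_nat n + 1) * summand n)"
proof -
  obtain m where p: "p = 2 * m + 1"
    using assms prime_odd_nat by (metis oddE)
  let ?t = "\<lambda>n. (42 * of_nat n ^ 2 + 23 * of_nat n + 3) / (2 * of_nat n + 1) * summand n"
  let ?x = "\<lambda>n. of_nat ((2 * n) choose n) * of_nat ((m - n) choose n) ^ 2 *
      (2 * (of_nat m - 2 * of_nat n) ^ 2 * (of_nat m - 2 * of_nat n - 1)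
        - of_nat n * (of_nat m - 2 * of_nat n) ^ 2 - of_nat n ^ 3) / (of_nat m - of_nat n) ^ 2 :: rat"
  have m: "m \<ge> 1"
    using assms p by simp
  have "{..<p} = {..m} \<union> {m<..<p}"
    using m by (auto simp: p)
  then have "sum ?t {..<p} = sum ?t {..m} + sum ?t {m<..<p}"
    by (simp add: sum.union_disjoint Int_def)
  \<comment> \<open>The terms \<open>?x n\<close> sum to exactly 0, so adding them changes nothing,
    but it makes each term divisible by \<open>p\<close>.\<close>
  also have "sum ?t {..m} = (\<Sum>n\<le>m. ?t n + ?x n)"
    using sum_binomial_eq_zero[OF m] by (simp add: sum.distrib)
  finally have "sum ?t {..<p} = (\<Sum>n\<le>m. ?t n + ?x n) + sum ?t {m<..<p}" .
  moreover have "padic_ge p 1 (\<Sum>n\<le>m. ?t n + ?x n)"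
    using assms(1) m unfolding p by (intro padic_ge_sum padic_ge_summand_lower_half) auto
  moreover have "padic_ge p 1 (sum ?t {m<..<p})"
    using assms(1) unfolding p by (intro padic_ge_sum padic_ge_summand_upper_half) auto
  ultimately show ?thesis
    using assms(1) by (simp add: padic_ge_add)
qed

text \<open>By \<open>sum_cubic_summand\<close> the sum is the telescoped end term, divisible by
  \<open>p\<close> through \<open>p^3\<close>, minus the quadratic sum.\<close>

lemma padic_ge_sum_cubic:
  fixes p :: nat
  assumes "prime p" "p > 2"
  shows "padic_ge p 1
    (\<Sum>n<p. (252 * of_nat n ^ 3 + 384 * of_nat n ^ 2 + 139 * of_nat n + 15) * summand n)"
proof -
  have "int p dvd 4 * int p ^ 3 * int ((4 * p) choose (2 * p)) ^ 2 * int ((2 * p) choose p)"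
    by (simp add: power3_eq_cube)
  moreover have "4 * of_nat p ^ 3 * summand p
      = of_int (4 * int p ^ 3 * int ((4 * p) choose (2 * p)) ^ 2 * int ((2 * p) choose p)) / of_int (16 ^ p)"
    by (simp add: summand_def)
  ultimately have "padic_ge p 1 (4 * of_nat p ^ 3 * summand p)"
    using not_dvd_16_power[OF assms] padic_geI by (metis power_one_right)
  then show ?thesis
    unfolding sum_cubic_summand using assms by (intro padic_ge_diff padic_ge_sum_quadratic)
qed

theorem theorem3:
  fixes p :: nat
  assumes "prime p" and "p > 2"
  shows "rat_cong_pow p 1
           (\<Sum>n = 0..p - 1.
              (42 * of_nat n ^ 2 + 23 * of_nat n + 3) / (2 ^ (4 * n) * (2 * of_nat n + 1))
              * of_nat ((4 * n) choose (2 * n)) ^ 2 * of_nat ((2 * n) choose n))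
           0
       \<and> rat_cong_pow p 1
           (\<Sum>n = 0..p - 1.
              (252 * of_nat n ^ 3 + 384 * of_nat n ^ 2 + 139 * of_nat n + 15) / 2 ^ (4 * n)
              * of_nat ((4 * n) choose (2 * n)) ^ 2 * of_nat ((2 * n) choose n))
           0"
proof -
  have "{0..p - 1} = {..<p}"
    using assms(2) by auto
  moreover have "(2 :: rat) ^ (4 * n) = 16 ^ n" for n
    by (simp add: power_mult)
  moreover have "rat_cong_pow p 1
      (\<Sum>n<p. (42 * of_nat n ^ 2 + 23 * of_nat n + 3) / (2 * of_nat n + 1) * summand n) 0"
    and "rat_cong_pow p 1
      (\<Sum>n<p. (252 * of_nat n ^ 3 + 384 * of_nat n ^ 2 + 139 * of_nat n + 15) * summand n) 0"
    using assms
    by (blast intro: rat_cong_pow_if_padic_ge padic_ge_sum_quadratic padic_ge_sum_cubic)+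
  ultimately show ?thesis
    by (simp add: summand_def mult.assoc mult.commute)
qed

end
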